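(* For any $n\in\mathbb{N}$, let $S_n=\sum_{i=1}^n s_i$ on the discrete monotone Fock space, let $\mu_n$ be its vacuum distribution and let $R_n:=\max A_n$ be the largest atom of $\mu_n$, where $A_1=\{1,-1\}$ and $A_{k+1}=\big\{\tfrac12\big(r\pm\sqrt{r^2+4}\big): r\in A_k\big\}$ for $k\ge1$. Then $$\sigma(S_n)=\mathrm{supp}(\mu_n)\qquad\text{and}\qquad \|S_n\|=R_n,$$ where $\sigma$ denotes the spectrum of an operator.
   Context: $\mathbb{N}=\{1,2,3,\ldots\}$. For $k\ge1$ let $I_k:=\{(i_1,\ldots,i_k): i_1<i_2<\cdots<i_k,\ i_j\in\mathbb{N}\}$. The discrete monotone Fock space is the Hilbert space $\mathcal{F}_m:=\bigoplus_{k\ge0}\mathcal{H}_k$, with $\mathcal{H}_0=\mathbb{C}\Omega$ ($\Omega$ a unit vector, the vacuum) and $\mathcal{H}_k=\ell^2(I_k)$ for $k\ge1$; its canonical orthonormal basis consists of $\Omega$ and the vectors $e_{(i_1,\ldots,i_k)}$, $(i_1,\ldots,i_k)\in I_k$, $k\ge 1$ (write $e_i=e_{(i)}$). For $i\in\mathbb{N}$ the monotone creation operator $a_i^\dagger$ and annihilation operator $a_i$ are the bounded, mutually adjoint operators with $a_i^\dagger\Omega=e_i$, $a_i\Omega=0$; $a_i^\dagger e_{(i_1,\ldots,i_k)}=e_{(i,i_1,\ldots,i_k)}$ if $i<i_1$ and $0$ otherwise; $a_i e_{(i_1,\ldots,i_k)}=e_{(i_2,\ldots,i_k)}$ if $i=i_1$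 and $0$ otherwise (with $a_ie_i=\Omega$). The position operator is $s_i:=a_i+a_i^\dagger$. The vacuum distribution $\mu_n$ of $S_n$ is the unique compactly supported probability measure on $\mathbb{R}$ with $\int x^p\,\mu_n(dx)=\langle S_n^p\Omega,\Omega\rangle$ for all $p\ge0$. The set $A_n$ is the set of the atoms of $\mu_n$. *)

theory Defs
  imports "HOL-Probability.Probability"
begin

section \<open>The discrete monotone Fock space\<close>

definition mono_tuples :: "nat \<Rightarrow> nat list set" where
  "mono_tuples k = {xs. length xs = k \<and> sorted_wrt (<) xs \<and> set xs \<subseteq> {1..}}"

definition mono_indices :: "nat list set" where
  "mono_indices = (\<Union>k. mono_tuples k)"

text \<open>
  The Hilbert sum of the spaces \<open>\<ell>\<^sup>2(mono_tuples k)\<close>, \<open>k \<ge> 0\<close>, is \<open>\<ell>\<^sup>2\<close> of the disjoint union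
  of the index sets. Since \<open>mono_tuples 0 = {[]}\<close>, the summand for \<open>k = 0\<close> is the line spanned by
  the vacuum vector. Elements are represented by their coordinate functions, extended by 0.
\<close>

typedef mono_fock =
  "{f :: nat list \<Rightarrow> complex. (\<forall>xs. xs \<notin> mono_indices \<longrightarrow> f xs = 0) \<and>
      (\<lambda>xs. (cmod (f xs))\<^sup>2) summable_on UNIV}"
  morphisms coord Abs_mono_fock
  by (rule exI[of _ "\<lambda>_. 0"]) simp

setup_lifting type_definition_mono_fock

lemma coord_outside: "xs \<notin> mono_indices \<Longrightarrow> coord f xs = 0"
  using coord[of f] by blast

lemma coord_square_summable: "(\<lambda>xs. (cmod (coord f xs))\<^sup>2) summable_on UNIV"
  using coord[of f] by blast

lemma mono_fock_eqI: "(\<And>xs. coord f xs = coord g xs) \<Longrightarrow> f = g"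
  by (metis coord_inject ext)

lemma square_summable_add:
  fixes f g :: "'a \<Rightarrow> complex"
  assumes "(\<lambda>x. (cmod (f x))\<^sup>2) summable_on A" "(\<lambda>x. (cmod (g x))\<^sup>2) summable_on A"
  shows "(\<lambda>x. (cmod (f x + g x))\<^sup>2) summable_on A"
proof (rule summable_on_comparison_test)
  show "(\<lambda>x. 2 * (cmod (f x))\<^sup>2 + 2 * (cmod (g x))\<^sup>2) summable_on A"
    using assms by (intro summable_on_add summable_on_cmult_right)
  fix x
  have "(cmod (f x + g x))\<^sup>2 \<le> (cmod (f x) + cmod (g x))\<^sup>2"
    by (intro power_mono norm_triangle_ineq) auto
  also have "\<dots> \<le> 2 * (cmod (f x))\<^sup>2 + 2 * (cmod (g x))\<^sup>2"
    using sum_squares_bound[of "cmod (f x)" "cmod (g x)"] by (simp add: power2_sum)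
  finally show "(cmod (f x + g x))\<^sup>2 \<le> 2 * (cmod (f x))\<^sup>2 + 2 * (cmod (g x))\<^sup>2" .
qed simp

lemma square_summable_scale:
  fixes f :: "'a \<Rightarrow> complex"
  assumes "(\<lambda>x. (cmod (f x))\<^sup>2) summable_on A"
  shows "(\<lambda>x. (cmod (c * f x))\<^sup>2) summable_on A"
  using summable_on_cmult_right[OF assms, of "(cmod c)\<^sup>2"]
  by (simp add: norm_mult power_mult_distrib)

lemma square_summable_inner:
  fixes f g :: "'a \<Rightarrow> complex"
  assumes "(\<lambda>x. (cmod (f x))\<^sup>2) summable_on A" "(\<lambda>x. (cmod (g x))\<^sup>2) summable_on A"
  shows "(\<lambda>x. f x * cnj (g x)) summable_on A"
proof (rule abs_summable_summable, rule summable_on_comparison_test)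
  show "(\<lambda>x. (cmod (f x))\<^sup>2 + (cmod (g x))\<^sup>2) summable_on A"
    using assms by (intro summable_on_add)
  fix x
  have "2 * (cmod (f x) * cmod (g x)) \<le> (cmod (f x))\<^sup>2 + (cmod (g x))\<^sup>2"
    using sum_squares_bound[of "cmod (f x)" "cmod (g x)"] by (simp add: mult.assoc)
  moreover have "0 \<le> cmod (f x) * cmod (g x)" by simp
  ultimately show "norm (f x * cnj (g x)) \<le> (cmod (f x))\<^sup>2 + (cmod (g x))\<^sup>2"
    unfolding norm_mult complex_mod_cnj by linarith
qed simp

lift_definition fock_scale :: "complex \<Rightarrow> mono_fock \<Rightarrow> mono_fock"
  is "\<lambda>c f xs. c * f xs"
  by (auto intro: square_summable_scale)

text \<open>The inner product is linear in the first argument.\<close>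

definition fock_cinner :: "mono_fock \<Rightarrow> mono_fock \<Rightarrow> complex" where
  "fock_cinner f g = (\<Sum>\<^sub>\<infinity>xs. coord f xs * cnj (coord g xs))"

lemma fock_cinner_summable: "(\<lambda>xs. coord f xs * cnj (coord g xs)) summable_on A"
  by (rule summable_on_subset_banach[OF square_summable_inner[OF coord_square_summable coord_square_summable]]) simp

instantiation mono_fock :: real_inner
begin

lift_definition zero_mono_fock :: mono_fock is "\<lambda>_. 0" by simp

lift_definition plus_mono_fock :: "mono_fock \<Rightarrow> mono_fock \<Rightarrow> mono_fock"
  is "\<lambda>f g xs. f xs + g xs"
  by (auto intro: square_summable_add)

lift_definition uminus_mono_fock :: "mono_fock \<Rightarrow> mono_fock" is "\<lambda>f xs. - f xs"
  by simp

definition minus_mono_fock :: "mono_fock \<Rightarrow> mono_fock \<Rightarrow> mono_fock" where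
  "minus_mono_fock f g = f + - g"

definition scaleR_mono_fock :: "real \<Rightarrow> mono_fock \<Rightarrow> mono_fock" where
  "scaleR_mono_fock r = fock_scale (complex_of_real r)"

definition inner_mono_fock :: "mono_fock \<Rightarrow> mono_fock \<Rightarrow> real" where
  "inner_mono_fock f g = Re (fock_cinner f g)"

definition norm_mono_fock :: "mono_fock \<Rightarrow> real" where
  "norm_mono_fock f = sqrt (inner f f)"

definition sgn_mono_fock :: "mono_fock \<Rightarrow> mono_fock" where
  "sgn_mono_fock f = scaleR (inverse (norm f)) f"

definition dist_mono_fock :: "mono_fock \<Rightarrow> mono_fock \<Rightarrow> real" where
  "dist_mono_fock f g = norm (f - g)"

definition uniformity_mono_fock :: "(mono_fock \<times> mono_fock) filter" where
  "uniformity_mono_fock = (INF e\<in>{0<..}. principal {(f, g). dist f g < e})"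

definition open_mono_fock :: "mono_fock set \<Rightarrow> bool" where
  "open_mono_fock U = (\<forall>f\<in>U. \<forall>\<^sub>F (f', g) in uniformity. f' = f \<longrightarrow> g \<in> U)"

lemma coord_basic:
  "coord 0 xs = 0" "coord (f + g) xs = coord f xs + coord g xs"
  "coord (- f) xs = - coord f xs" "coord (r *\<^sub>R f) xs = complex_of_real r * coord f xs"
  by (simp_all only: zero_mono_fock.rep_eq plus_mono_fock.rep_eq uminus_mono_fock.rep_eq
      scaleR_mono_fock_def fock_scale.rep_eq)

lemma fock_cinner_self:
  "fock_cinner f f = complex_of_real (\<Sum>\<^sub>\<infinity>xs. (cmod (coord f xs))\<^sup>2)"
proof -
  have "((\<lambda>xs. complex_of_real ((cmod (coord f xs))\<^sup>2)) has_sum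
      complex_of_real (\<Sum>\<^sub>\<infinity>xs. (cmod (coord f xs))\<^sup>2)) UNIV"
    using coord_square_summable[of f] by (intro has_sum_of_real) simp
  thus ?thesis
    unfolding fock_cinner_def complex_norm_square by (rule infsumI)
qed

instance
proof
  fix f g h :: mono_fock and r s :: real
  show "f - g = f + - g" by (rule minus_mono_fock_def)
  show "f + g + h = f + (g + h)" "f + g = g + f" "0 + f = f" "- f + f = 0"
    by (rule mono_fock_eqI; simp add: coord_basic)+
  show "r *\<^sub>R (f + g) = r *\<^sub>R f + r *\<^sub>R g" "(r + s) *\<^sub>R f = r *\<^sub>R f + s *\<^sub>R f"
    "r *\<^sub>R s *\<^sub>R f = (r * s) *\<^sub>R f" "1 *\<^sub>R f = f"
    by (rule mono_fock_eqI; simp add: coord_basic algebra_simps)+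
  show "sgn f = scaleR (inverse (norm f)) f" "dist f g = norm (f - g)"
    "uniformity = (INF e\<in>{0<..}. principal {(f, g). dist (f::mono_fock) g < e})"
    "norm f = sqrt (inner f f)"
    by (rule sgn_mono_fock_def dist_mono_fock_def uniformity_mono_fock_def norm_mono_fock_def)+
  show "open U = (\<forall>f\<in>U. \<forall>\<^sub>F (f', g) in uniformity. f' = f \<longrightarrow> g \<in> U)" for U :: "mono_fock set"
    by (rule open_mono_fock_def)
  have "fock_cinner g f = cnj (fock_cinner f g)"
    unfolding fock_cinner_def infsum_cnj[symmetric]
    by (rule infsum_cong) simp
  thus "inner f g = inner g f" by (simp add: inner_mono_fock_def)
  have "fock_cinner (f + g) h = fock_cinner f h + fock_cinner g h"
    unfolding fock_cinner_def coord_basic distrib_right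
    by (rule infsum_add[OF fock_cinner_summable fock_cinner_summable])
  thus "inner (f + g) h = inner f h + inner g h" by (simp add: inner_mono_fock_def)
  have "fock_cinner (r *\<^sub>R f) g = complex_of_real r * fock_cinner f g"
    unfolding fock_cinner_def coord_basic mult.assoc by (rule infsum_cmult_right')
  thus "inner (r *\<^sub>R f) g = r * inner f g" by (simp add: inner_mono_fock_def)
  show "0 \<le> inner f f"
    by (simp add: inner_mono_fock_def fock_cinner_self infsum_nonneg)
  have "coord f xs = 0" if "inner f f = 0" for xs
  proof -
    have "(cmod (coord f xs))\<^sup>2 = 0"
      using that
      by (intro nonneg_infsum_le_0D[OF _ coord_square_summable])
        (simp_all add: inner_mono_fock_def fock_cinner_self)
    thus ?thesis by simp
  qed
  moreover have "inner (0::mono_fock) 0 = 0"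
    by (simp add: inner_mono_fock_def fock_cinner_def coord_basic)
  ultimately show "inner f f = 0 \<longleftrightarrow> f = 0"
    by (metis mono_fock_eqI coord_basic(1))
qed

end

lemma norm_mono_fock_square: "(norm f)\<^sup>2 = (\<Sum>\<^sub>\<infinity>xs. (cmod (coord f xs))\<^sup>2)" for f :: mono_fock
  unfolding norm_mono_fock_def
  by (simp add: inner_mono_fock_def fock_cinner_self infsum_nonneg)

lift_definition fock_basis :: "nat list \<Rightarrow> mono_fock"
  is "\<lambda>xs ys. if ys = xs \<and> xs \<in> mono_indices then 1 else 0"
proof (intro CollectI conjI allI impI)
  fix xs :: "nat list"
  show "(\<lambda>ys. (cmod (if ys = xs \<and> xs \<in> mono_indices then 1 else 0))\<^sup>2) summable_on UNIV"
    by (rule finite_nonzero_values_imp_summable_on, rule finite_subset[of _ "{xs}"]) auto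
qed auto

lemma fock_cinner_fock_basis:
  assumes "xs \<in> mono_indices"
  shows "fock_cinner f (fock_basis xs) = coord f xs"
proof -
  have "fock_cinner f (fock_basis xs) =
      (\<Sum>\<^sub>\<infinity>ys\<in>{xs}. coord f ys * cnj (coord (fock_basis xs) ys))"
    unfolding fock_cinner_def by (rule infsum_cong_neutral) (auto simp: fock_basis.rep_eq)
  thus ?thesis using assms by (simp add: fock_basis.rep_eq)
qed

definition vacuum :: mono_fock where
  "vacuum = fock_basis []"


section \<open>Creation, annihilation and position operators\<close>

lemma mono_indices_iff: "xs \<in> mono_indices \<longleftrightarrow> sorted_wrt (<) xs \<and> set xs \<subseteq> {1..}"
  by (auto simp: mono_indices_def mono_tuples_def)

lemma mono_indices_Cons: "i # xs \<in> mono_indices \<Longrightarrow> xs \<in> mono_indices"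
  by (simp add: mono_indices_iff)

lemma square_summable_Cons:
  assumes "(\<lambda>xs. (cmod (f xs))\<^sup>2) summable_on UNIV"
  shows "(\<lambda>xs. (cmod (f (i # xs)))\<^sup>2) summable_on UNIV"
proof -
  have "(\<lambda>xs. (cmod (f xs))\<^sup>2) summable_on range ((#) i)"
    by (rule summable_on_subset_banach[OF assms]) simp
  thus ?thesis by (subst (asm) summable_on_reindex) (auto simp: inj_on_def o_def)
qed

lemma square_summable_creation:
  assumes "(\<lambda>xs. (cmod (f xs))\<^sup>2) summable_on UNIV"
  shows "(\<lambda>xs. (cmod (case xs of [] \<Rightarrow> 0
    | j # ys \<Rightarrow> if j = i \<and> i # ys \<in> mono_indices then f ys else 0))\<^sup>2) summable_on UNIV"
    (is "(\<lambda>xs. (cmod (?g xs))\<^sup>2) summable_on UNIV")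
proof -
  have "(\<lambda>xs. (cmod (if i # xs \<in> mono_indices then f xs else 0))\<^sup>2) summable_on UNIV"
    using assms by (rule summable_on_comparison_test) auto
  hence "(\<lambda>xs. (cmod (?g xs))\<^sup>2) summable_on range ((#) i)"
    by (subst summable_on_reindex) (auto simp: inj_on_def o_def)
  thus ?thesis
    by (rule summable_on_cong_neutral[THEN iffD1, rotated -1]) (auto split: list.split)
qed

text \<open>
  The operators are given by their action on coordinates; the lemmas below verify that they are
  the bounded, mutually adjoint operators with the usual action on the canonical basis.
\<close>

lift_definition creation :: "nat \<Rightarrow> mono_fock \<Rightarrow> mono_fock"
  is "\<lambda>i f xs. case xs of [] \<Rightarrow> 0 | j # ys \<Rightarrow> if j = i \<and> i # ys \<in> mono_indices then f ys else 0"
  by (auto intro: square_summable_creation split: list.split)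

lift_definition annihilation :: "nat \<Rightarrow> mono_fock \<Rightarrow> mono_fock"
  is "\<lambda>i f xs. f (i # xs)"
  by (auto intro: square_summable_Cons dest: mono_indices_Cons)

definition position :: "nat \<Rightarrow> mono_fock \<Rightarrow> mono_fock" where
  "position i f = annihilation i f + creation i f"

definition position_sum :: "nat \<Rightarrow> mono_fock \<Rightarrow> mono_fock" where
  "position_sum n f = (\<Sum>i = 1..n. position i f)"

lemma creation_vacuum: "1 \<le> i \<Longrightarrow> creation i vacuum = fock_basis [i]"
  unfolding vacuum_def by transfer (auto simp: mono_indices_iff fun_eq_iff split: list.split)

lemma annihilation_vacuum: "annihilation i vacuum = 0"
  unfolding vacuum_def by transfer auto

lemma creation_fock_basis:
  assumes "1 \<le> i" "j # xs \<in> mono_indices"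
  shows "creation i (fock_basis (j # xs)) = (if i < j then fock_basis (i # j # xs) else 0)"
  using assms
  by transfer (auto simp: mono_indices_iff fun_eq_iff split: list.split)

lemma annihilation_fock_basis:
  assumes "j # xs \<in> mono_indices"
  shows "annihilation i (fock_basis (j # xs)) = (if i = j then fock_basis xs else 0)"
  using assms mono_indices_Cons[OF assms] by transfer (auto simp: fun_eq_iff)

lemma fock_cinner_creation: "fock_cinner (creation i f) g = fock_cinner f (annihilation i g)"
proof -
  have "fock_cinner (creation i f) g =
      (\<Sum>\<^sub>\<infinity>xs\<in>range ((#) i). coord (creation i f) xs * cnj (coord g xs))"
    unfolding fock_cinner_def
    by (rule infsum_cong_neutral) (auto simp: creation.rep_eq split: list.split)
  also have "\<dots> = (\<Sum>\<^sub>\<infinity>xs. coord (creation i f) (i # xs) * cnj (coord g (i # xs)))"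
    by (subst infsum_reindex) (auto simp: inj_on_def o_def)
  also have "\<dots> = fock_cinner f (annihilation i g)"
    unfolding fock_cinner_def
    by (rule infsum_cong) (auto simp: creation.rep_eq annihilation.rep_eq coord_outside)
  finally show ?thesis .
qed

definition bounded_clinear_fock :: "(mono_fock \<Rightarrow> mono_fock) \<Rightarrow> bool" where
  "bounded_clinear_fock T \<longleftrightarrow> bounded_linear T \<and> (\<forall>c f. T (fock_scale c f) = fock_scale c (T f))"

lemma norm_annihilation_le: "norm (annihilation i f) \<le> norm f"
proof (rule power2_le_imp_le)
  have "(norm (annihilation i f))\<^sup>2 = (\<Sum>\<^sub>\<infinity>xs\<in>range ((#) i). (cmod (coord f xs))\<^sup>2)"
    unfolding norm_mono_fock_square annihilation.rep_eq
    by (subst infsum_reindex) (simp_all add: inj_on_def comp_def)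
  also have "\<dots> \<le> (norm f)\<^sup>2"
    unfolding norm_mono_fock_square
    by (rule infsum_mono_neutral[OF summable_on_subset_banach[OF coord_square_summable]
          coord_square_summable]) simp_all
  finally show "(norm (annihilation i f))\<^sup>2 \<le> (norm f)\<^sup>2" .
qed simp

lemma norm_creation_le: "norm (creation i f) \<le> norm f"
proof (rule power2_le_imp_le)
  have "(norm (creation i f))\<^sup>2 = inner (creation i f) (creation i f)"
    by (rule power2_norm_eq_inner)
  also have "\<dots> = inner f (annihilation i (creation i f))"
    by (simp add: inner_mono_fock_def fock_cinner_creation)
  also have "\<dots> \<le> norm f * norm (annihilation i (creation i f))"
    by (rule norm_cauchy_schwarz)
  also have "\<dots> \<le> norm f * norm (creation i f)"
    by (intro mult_left_mono norm_annihilation_le) simp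
  finally have "norm (creation i f) \<le> norm f"
    by (cases "norm (creation i f) = 0") (auto simp: power2_eq_square)
  thus "(norm (creation i f))\<^sup>2 \<le> (norm f)\<^sup>2" by (intro power_mono) auto
qed simp

lemma bounded_clinear_annihilation: "bounded_clinear_fock (annihilation i)"
  unfolding bounded_clinear_fock_def
proof (intro conjI allI bounded_linear_intro[of _ 1])
  show "annihilation i (fock_scale c f) = fock_scale c (annihilation i f)" for c f
    by transfer simp
qed (auto intro!: mono_fock_eqI norm_annihilation_le simp: annihilation.rep_eq coord_basic)

lemma bounded_clinear_creation: "bounded_clinear_fock (creation i)"
  unfolding bounded_clinear_fock_def
proof (intro conjI allI bounded_linear_intro[of _ 1])
  show "creation i (fock_scale c f) = fock_scale c (creation i f)" for c f
    by transfer (auto simp: fun_eq_iff split: list.split)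
qed (auto intro!: mono_fock_eqI norm_creation_le simp: creation.rep_eq coord_basic split: list.split)


section \<open>Spectrum and vacuum distribution\<close>

definition fock_spectrum :: "(mono_fock \<Rightarrow> mono_fock) \<Rightarrow> complex set" where
  "fock_spectrum T = {z. \<not> (\<exists>R. bounded_clinear_fock R \<and>
      (\<forall>f. R (T f - fock_scale z f) = f) \<and> (\<forall>f. T (R f) - fock_scale z (R f) = f))}"

definition measure_support :: "real measure \<Rightarrow> real set" where
  "measure_support M = {x. \<forall>U. open U \<and> x \<in> U \<longrightarrow> emeasure M U > 0}"

definition measure_atoms :: "real measure \<Rightarrow> real set" where
  "measure_atoms M = {x. emeasure M {x} > 0}"

definition vacuum_distribution :: "(mono_fock \<Rightarrow> mono_fock) \<Rightarrow> real measure" where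
  "vacuum_distribution T = (THE M. prob_space M \<and> sets M = sets borel \<and>
      compact (measure_support M) \<and>
      (\<forall>p. complex_of_real (\<integral>x. x ^ p \<partial>M) = fock_cinner ((T ^^ p) vacuum) vacuum))"

text \<open>The value at 0 is a dummy.\<close>

fun atom_set :: "nat \<Rightarrow> real set" where
  "atom_set 0 = {}"
| "atom_set (Suc 0) = {1, -1}"
| "atom_set (Suc (Suc k)) =
    (\<Union>r\<in>atom_set (Suc k). {(r + sqrt (r\<^sup>2 + 4)) / 2, (r - sqrt (r\<^sup>2 + 4)) / 2})"

end

theory Submission
  imports Defs
begin

text \<open>
  Let \<open>a\<^sub>j\<close> and \<open>a\<^sub>j\<^sup>\<dagger>\<close> be annihilation and creation of the letter \<open>j\<close>, let \<open>U\<close> be the sum of the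
  position operators over the letters \<open>m + 1, \<dots>, n\<close>, and consider the vectors \<open>u + a\<^sub>m\<^sup>\<dagger> v\<close>, where \<open>u\<close>
  and \<open>v\<close> are supported on words with letters greater than \<open>m\<close>. A word that starts with \<open>m\<close> can
  neither lose nor gain a leading letter greater than \<open>m\<close>, so adding the position operator of \<open>m\<close>
  to \<open>U\<close> gives the operator \<open>(u, v) \<mapsto> (U u + v, u)\<close> (lemma \<open>position_block_Suc\<close>). If \<open>U u = r u\<close>
  and \<open>x - 1/x = r\<close>, then \<open>(u, u/x)\<close> is an eigenvector of this operator for \<open>x\<close>. There are two such
  \<open>x\<close>, the eigenvalues of a symmetric \<open>2 \<times> 2\<close> matrix, so these vectors span all \<open>(\<alpha> u, \<beta> u)\<close>. Starting from the
  empty sum, whose only eigenvalue is 0, every vector of the Fock space is by induction a finite sum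
  of eigenvectors of \<open>S\<^sub>n\<close>, with eigenvalues in the \<open>n\<close>-th iterated preimage of 0 under
  \<open>x \<mapsto> x - 1/x\<close>, which is the set \<open>A\<^sub>n\<close> (lemmas \<open>position_block_expansion\<close> and \<open>atom_set_eq\<close>).
  Each of these eigenvalues has an eigenvector with nonzero vacuum component, because passing from
  \<open>u\<close> to \<open>(u, u/x)\<close> keeps the coordinate at the empty word (lemma \<open>position_block_eigenvector\<close>).

  The rest is spectral theory of a symmetric operator with such an expansion (locale
  \<open>finite_spectral_fock\<close>). Eigenvectors for different eigenvalues are orthogonal, so Pythagoras'
  theorem bounds the operator by its largest eigenvalue in modulus, and its resolvent by the
  inverse distance to the eigenvalues. Expanding \<open>\<Omega> = \<Sum>\<^sub>a g\<^sub>a\<close> identifies the vacuum distribution as the sum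
  of the point masses \<open>\<parallel>g\<^sub>a\<parallel>\<^sup>2\<close> at \<open>a\<close>, none of which vanishes. Finally \<open>A\<^sub>n\<close> is symmetric about 0, so
  its maximum is its largest modulus.
\<close>

section \<open>The complex inner product\<close>

lemma coord_diff: "coord (f - g) xs = coord f xs - coord g xs"
  unfolding minus_mono_fock_def coord_basic by simp

lemma fock_cinner_commute: "fock_cinner g f = cnj (fock_cinner f g)"
  unfolding fock_cinner_def infsum_cnj[symmetric] by (rule infsum_cong) simp

lemma fock_cinner_add_left: "fock_cinner (f + g) h = fock_cinner f h + fock_cinner g h"
  unfolding fock_cinner_def coord_basic distrib_right
  by (rule infsum_add[OF fock_cinner_summable fock_cinner_summable])

lemma fock_cinner_add_right: "fock_cinner h (f + g) = fock_cinner h f + fock_cinner h g"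
  by (simp add: fock_cinner_commute[of h] fock_cinner_add_left)

lemma fock_cinner_scaleR_left: "fock_cinner (r *\<^sub>R f) g = complex_of_real r * fock_cinner f g"
  unfolding fock_cinner_def coord_basic mult.assoc by (rule infsum_cmult_right')

lemma fock_cinner_scaleR_right: "fock_cinner f (r *\<^sub>R g) = complex_of_real r * fock_cinner f g"
  by (simp add: fock_cinner_commute[of f] fock_cinner_scaleR_left)

lemma fock_cinner_zero_left: "fock_cinner 0 g = 0"
  by (simp add: fock_cinner_def coord_basic)

lemma fock_cinner_sum_left: "fock_cinner (\<Sum>a\<in>A. g a) h = (\<Sum>a\<in>A. fock_cinner (g a) h)"
  by (induction A rule: infinite_finite_induct)
    (simp_all add: fock_cinner_zero_left fock_cinner_add_left)

lemma fock_cinner_sum_right: "fock_cinner h (\<Sum>a\<in>A. g a) = (\<Sum>a\<in>A. fock_cinner h (g a))"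
  by (simp add: fock_cinner_commute[of h] fock_cinner_sum_left)

lemma fock_cinner_self_norm: "fock_cinner f f = complex_of_real ((norm f)\<^sup>2)"
  by (simp add: fock_cinner_self norm_mono_fock_square)

lemma norm_fock_scale: "norm (fock_scale c f) = cmod c * norm f"
proof (rule power2_eq_imp_eq)
  show "(norm (fock_scale c f))\<^sup>2 = (cmod c * norm f)\<^sup>2"
    unfolding norm_mono_fock_square power_mult_distrib fock_scale.rep_eq norm_mult
    by (rule infsum_cmult_right')
qed simp_all

lemma fock_scale_of_real: "fock_scale (complex_of_real r) f = r *\<^sub>R f"
  by (simp add: scaleR_mono_fock_def)

lemma fock_scale_diff_right: "fock_scale c (f - g) = fock_scale c f - fock_scale c g"
  by (rule mono_fock_eqI) (simp add: coord_diff fock_scale.rep_eq algebra_simps)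

lemma bounded_linear_fock_scale: "bounded_linear (fock_scale c)"
proof (rule bounded_linear_intro[of _ "cmod c"])
  show "norm (fock_scale c f) \<le> norm f * cmod c" for f by (simp add: norm_fock_scale)
qed (auto intro!: mono_fock_eqI simp: coord_basic fock_scale.rep_eq algebra_simps)

lemma coord_vacuum_eq_cinner: "fock_cinner f vacuum = coord f []"
  unfolding vacuum_def by (rule fock_cinner_fock_basis) (simp add: mono_indices_iff)

lemma norm_vacuum: "norm vacuum = 1"
proof -
  have "complex_of_real ((norm vacuum)\<^sup>2) = coord vacuum []"
    by (simp only: fock_cinner_self_norm[symmetric] coord_vacuum_eq_cinner)
  also have "\<dots> = 1" by (simp add: vacuum_def fock_basis.rep_eq mono_indices_iff)
  finally show ?thesis
    by (metis of_real_eq_1_iff norm_ge_zero power2_eq_1_iff not_one_le_zero neg_0_le_iff_le)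
qed


section \<open>A moment problem with finitely many atoms\<close>

lemma emeasure_Compl_measure_support:
  assumes "sets M = sets borel"
  shows "emeasure M (- measure_support M) = 0"
proof -
  let ?\<U> = "{U. open U \<and> emeasure M U = 0}"
  have eq: "- measure_support M = \<Union>?\<U>"
    by (auto simp: measure_support_def zero_less_iff_neq_zero)
  obtain \<V> where \<V>: "\<V> \<subseteq> ?\<U>" "countable \<V>" "\<Union>\<V> = \<Union>?\<U>"
    by (rule Lindelof[of ?\<U>]) auto
  have "(\<Union>U\<in>\<V>. U) \<in> null_sets M"
    using \<V>(1) assms by (intro null_sets_UN'[OF \<V>(2)]) (auto simp: null_sets_def)
  thus ?thesis using eq \<V>(3) by (simp add: null_sets_def)
qed

lemma integrable_power_of_compact_support:
  assumes "prob_space M" and sets: "sets M = sets borel" and "compact (measure_support M)"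
  shows "integrable M (\<lambda>x. x ^ p)"
proof -
  interpret prob_space M by fact
  obtain K where K: "\<And>x. x \<in> measure_support M \<Longrightarrow> \<bar>x\<bar> \<le> K"
    using compact_imp_bounded[OF assms(3)] by (auto simp: bounded_iff)
  have "- measure_support M \<in> null_sets M"
    using emeasure_Compl_measure_support[OF sets] compact_imp_closed[OF assms(3)]
    by (auto simp: null_sets_def sets)
  hence "AE x in M. x \<in> measure_support M"
    by (rule AE_I') (auto simp: Compl_eq)
  hence "AE x in M. norm (x ^ p) \<le> K ^ p"
    by eventually_elim (auto simp: power_abs intro!: power_mono K)
  thus ?thesis
    by (rule integrable_const_bound) (simp add: measurable_cong_sets[OF sets refl])
qed

text \<open>
  A measure on the line cannot escape the nodes \<open>B\<close> of a finite moment sequence, because the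
  nonnegative polynomial \<open>\<Prod>b\<in>B. (x - b)\<^sup>2\<close> then has integral 0. The weight of a node is read off
  from a polynomial which vanishes at all other nodes.
\<close>

lemma finite_moment_problem_determinate:
  fixes B :: "real set"
  assumes "prob_space M" and sets: "sets M = sets borel" and "compact (measure_support M)"
    and "finite B" and moments: "\<And>p. (\<integral>x. x ^ p \<partial>M) = (\<Sum>b\<in>B. w b * b ^ p)"
    and U: "U \<in> sets borel"
  shows "measure M U = (\<Sum>b\<in>B \<inter> U. w b)"
proof -
  interpret prob_space M by fact
  note int_power = integrable_power_of_compact_support[OF assms(1-3)]
  have int_poly: "integrable M (poly q)" for q
    unfolding poly_altdef by (intro Bochner_Integration.integrable_sum integrable_mult_right int_power)
  have poly_integral: "(\<integral>x. poly q x \<partial>M) = (\<Sum>b\<in>B. w b * poly q b)" for q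
  proof -
    have "(\<integral>x. poly q x \<partial>M) = (\<Sum>i\<le>degree q. coeff q i * (\<integral>x. x ^ i \<partial>M))"
      unfolding poly_altdef by (subst Bochner_Integration.integral_sum) (auto intro: int_power)
    also have "\<dots> = (\<Sum>b\<in>B. w b * poly q b)"
      unfolding moments poly_altdef sum_distrib_left
      by (subst sum.swap) (simp add: mult_ac)
    finally show ?thesis .
  qed
  define q where "q = (\<Prod>b\<in>B. [:- b, 1:] ^ 2)"
  have q: "poly q x = (\<Prod>b\<in>B. (x - b)\<^sup>2)" for x
    by (simp add: q_def poly_prod)
  have "(\<integral>x. poly q x \<partial>M) = 0"
    unfolding poly_integral using \<open>finite B\<close> by (auto simp: q intro!: sum.neutral)
  hence "AE x in M. poly q x = 0"
    by (subst (asm) integral_nonneg_eq_0_iff_AE) (auto simp: int_poly q prod_nonneg)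
  hence AE_B: "AE x in M. x \<in> B"
    by eventually_elim (use \<open>finite B\<close> in \<open>auto simp: q\<close>)
  have atom: "measure M {a} = w a" if "a \<in> B" for a
  proof -
    define l where "l = (\<Prod>b\<in>B - {a}. [:- b, 1:])"
    have l: "poly l x = (\<Prod>b\<in>B - {a}. x - b)" for x
      by (simp add: l_def poly_prod)
    have l0: "poly l b = 0" if "b \<in> B" "b \<noteq> a" for b
      using that \<open>finite B\<close> by (auto simp: l)
    have "poly l a \<noteq> 0" using \<open>finite B\<close> by (auto simp: l)
    have "(\<integral>x. poly l x \<partial>M) = (\<integral>x. poly l a * indicator {a} x \<partial>M)"
    proof (rule integral_cong_AE)
      show "AE x in M. poly l x = poly l a * indicator {a} x"
        using AE_B by eventually_elim (auto simp: indicator_def l0)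
      show "(\<lambda>x. poly l a * indicator {a} x) \<in> borel_measurable M"
        using sets by (intro borel_measurable_times borel_measurable_indicator) auto
    qed (use int_poly in auto)
    also have "\<dots> = poly l a * measure M {a}"
      using sets_eq_imp_space_eq[OF sets] by simp
    also have "(\<integral>x. poly l x \<partial>M) = w a * poly l a"
      unfolding poly_integral using \<open>finite B\<close> \<open>a \<in> B\<close>
      by (subst sum.remove[of _ a]) (auto simp: l0 intro!: sum.neutral)
    finally show ?thesis using \<open>poly l a \<noteq> 0\<close> by simp
  qed
  have "measure M U = measure M (B \<inter> U)"
    using AE_B U sets \<open>finite B\<close>
    by (intro finite_measure_eq_AE) (auto elim!: eventually_mono intro: borel_closed finite_imp_closed)
  also have "\<dots> = (\<Sum>b\<in>B \<inter> U. measure M {b})"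
    using \<open>finite B\<close> sets by (intro finite_measure_eq_sum_singleton) auto
  also have "\<dots> = (\<Sum>b\<in>B \<inter> U. w b)"
    by (rule sum.cong) (auto simp: atom)
  finally show ?thesis .
qed

text \<open>The identity map carries the measure from the discrete space \<open>B\<close> to the Borel line.\<close>

definition atomic_measure :: "real set \<Rightarrow> (real \<Rightarrow> real) \<Rightarrow> real measure" where
  "atomic_measure B w = distr (point_measure B (\<lambda>b. ennreal (w b))) borel (\<lambda>x. x)"

lemma sets_atomic_measure [simp]: "sets (atomic_measure B w) = sets borel"
  by (simp add: atomic_measure_def)

lemma measurable_point_measure_borel: "f \<in> measurable (point_measure B w) borel"
  by (simp add: measurable_point_measure_eq1)

lemma emeasure_atomic_measure:
  assumes "finite B" "\<And>b. b \<in> B \<Longrightarrow> 0 \<le> w b" "U \<in> sets borel"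
  shows "emeasure (atomic_measure B w) U = ennreal (\<Sum>b\<in>B \<inter> U. w b)"
proof -
  have "emeasure (atomic_measure B w) U = emeasure (point_measure B (\<lambda>b. ennreal (w b))) (B \<inter> U)"
    unfolding atomic_measure_def using assms(3)
    by (subst emeasure_distr) (auto simp: measurable_point_measure_borel space_point_measure Int_commute)
  also have "\<dots> = ennreal (\<Sum>b\<in>B \<inter> U. w b)"
    using assms(1,2) by (subst emeasure_point_measure_finite) (auto intro!: sum_ennreal)
  finally show ?thesis .
qed

lemma emeasure_atomic_measure_pos_iff:
  assumes "finite B" "\<And>b. b \<in> B \<Longrightarrow> 0 < w b" "U \<in> sets borel"
  shows "emeasure (atomic_measure B w) U > 0 \<longleftrightarrow> B \<inter> U \<noteq> {}"
proof -
  have "(\<Sum>b\<in>B \<inter> U. w b) > 0" if "B \<inter> U \<noteq> {}"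
    using assms that by (intro sum_pos) auto
  thus ?thesis using assms by (subst emeasure_atomic_measure) (auto intro: less_imp_le)
qed

lemma measure_atoms_atomic_measure:
  assumes "finite B" "\<And>b. b \<in> B \<Longrightarrow> 0 < w b"
  shows "measure_atoms (atomic_measure B w) = B"
  unfolding measure_atoms_def using emeasure_atomic_measure_pos_iff[OF assms] by auto

lemma measure_support_atomic_measure:
  assumes "finite B" "\<And>b. b \<in> B \<Longrightarrow> 0 < w b"
  shows "measure_support (atomic_measure B w) = B"
proof -
  have "x \<in> measure_support (atomic_measure B w) \<longleftrightarrow> (\<forall>U. open U \<and> x \<in> U \<longrightarrow> B \<inter> U \<noteq> {})" for x
    unfolding measure_support_def using emeasure_atomic_measure_pos_iff[OF assms] by auto
  moreover have "open (- B)" using finite_imp_closed[OF assms(1)] by (simp add: open_Compl)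
  ultimately show ?thesis by blast
qed

lemma prob_space_atomic_measure:
  assumes "finite B" "\<And>b. b \<in> B \<Longrightarrow> 0 \<le> w b" "(\<Sum>b\<in>B. w b) = 1"
  shows "prob_space (atomic_measure B w)"
proof (rule prob_spaceI)
  have "space (atomic_measure B w) = UNIV" by (simp add: atomic_measure_def)
  thus "emeasure (atomic_measure B w) (space (atomic_measure B w)) = 1"
    using assms by (simp add: emeasure_atomic_measure)
qed

lemma integral_power_atomic_measure:
  assumes "finite B" "\<And>b. b \<in> B \<Longrightarrow> 0 \<le> w b"
  shows "(\<integral>x. x ^ p \<partial>atomic_measure B w) = (\<Sum>b\<in>B. w b * b ^ p)"
  unfolding atomic_measure_def using assms
  by (subst integral_distr)
    (auto simp: measurable_point_measure_borel lebesgue_integral_point_measure_finite)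


section \<open>Symmetric operators with a finite eigenvector expansion\<close>

definition symmetric_fock :: "(mono_fock \<Rightarrow> mono_fock) \<Rightarrow> bool" where
  "symmetric_fock T \<longleftrightarrow> (\<forall>f g. fock_cinner (T f) g = fock_cinner f (T g))"

definition eigen_expansion ::
    "(mono_fock \<Rightarrow> mono_fock) \<Rightarrow> real set \<Rightarrow> mono_fock \<Rightarrow> (real \<Rightarrow> mono_fock) \<Rightarrow> bool" where
  "eigen_expansion T B f g \<longleftrightarrow> f = (\<Sum>a\<in>B. g a) \<and> (\<forall>a\<in>B. T (g a) = a *\<^sub>R g a)"

lemma eigenvectors_orthogonal:
  assumes "symmetric_fock T" "T f = a *\<^sub>R f" "T g = b *\<^sub>R g" "a \<noteq> b"
  shows "fock_cinner f g = 0"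
proof -
  have "complex_of_real a * fock_cinner f g = complex_of_real b * fock_cinner f g"
    using assms(1-3) unfolding symmetric_fock_def
    by (metis fock_cinner_scaleR_left fock_cinner_scaleR_right)
  thus ?thesis using assms(4) by simp
qed

text \<open>
  The expansion makes the spectrum at most \<open>B\<close>. The eigenvectors, being not orthogonal to the vacuum,
  make every point of \<open>B\<close> an eigenvalue and, moreover, one which the vacuum distribution sees.
\<close>

locale finite_spectral_fock =
  fixes T :: "mono_fock \<Rightarrow> mono_fock" and B :: "real set"
  assumes bounded: "bounded_clinear_fock T"
    and symmetric: "symmetric_fock T"
    and finite_B: "finite B"
    and expansion: "\<exists>g. eigen_expansion T B f g"
    and eigenvector: "a \<in> B \<Longrightarrow> \<exists>h. T h = a *\<^sub>R h \<and> coord h [] \<noteq> 0"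
begin

lemma bounded_linear_T: "bounded_linear T"
  using bounded by (simp add: bounded_clinear_fock_def)

lemma T_scale: "T (fock_scale c f) = fock_scale c (T f)"
  using bounded by (simp add: bounded_clinear_fock_def)

lemmas T_linear = linear_simps[OF bounded_linear_T]

lemma T_sum: "T (\<Sum>a\<in>A. g a) = (\<Sum>a\<in>A. T (g a))"
  by (rule linear_sum[OF bounded_linear.linear[OF bounded_linear_T]])

lemma expansion_orthogonal:
  assumes "eigen_expansion T B f g" "a \<in> B" "b \<in> B" "a \<noteq> b"
  shows "fock_cinner (g a) (g b) = 0"
  using assms eigenvectors_orthogonal[OF symmetric, of "g a" a "g b" b]
  by (simp add: eigen_expansion_def)

text \<open>
  Scaling the summands of an eigenvector expansion keeps them orthogonal. Applied with the
  coefficients \<open>a\<close> and \<open>a - z\<close>, this controls the norms of \<open>T\<close> and of its resolvent.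
\<close>

lemma norm_scaled_expansion:
  assumes "eigen_expansion T B f g"
  shows "(norm (\<Sum>a\<in>B. fock_scale (c a) (g a)))\<^sup>2 = (\<Sum>a\<in>B. (cmod (c a))\<^sup>2 * (norm (g a))\<^sup>2)"
proof -
  have "T (fock_scale (c a) (g a)) = a *\<^sub>R fock_scale (c a) (g a)" if "a \<in> B" for a
    using assms that
    by (auto intro!: mono_fock_eqI simp: eigen_expansion_def T_scale coord_basic fock_scale.rep_eq)
  hence "pairwise (\<lambda>a b. orthogonal (fock_scale (c a) (g a)) (fock_scale (c b) (g b))) B"
    by (simp add: pairwise_def orthogonal_def inner_mono_fock_def)
      (metis eigenvectors_orthogonal[OF symmetric] zero_complex.sel(1))
  from norm_sum_Pythagorean[OF finite_B this] show ?thesis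
    by (simp add: norm_fock_scale power_mult_distrib)
qed

lemma norm_expansion:
  assumes "eigen_expansion T B f g"
  shows "(norm f)\<^sup>2 = (\<Sum>a\<in>B. (norm (g a))\<^sup>2)"
proof -
  have "f = (\<Sum>a\<in>B. fock_scale 1 (g a))"
    using assms fock_scale_of_real[of 1] by (simp add: eigen_expansion_def)
  thus ?thesis using norm_scaled_expansion[OF assms, of "\<lambda>_. 1"] by simp
qed

lemma T_minus_expansion:
  assumes "eigen_expansion T B f g"
  shows "T f - fock_scale z f = (\<Sum>a\<in>B. fock_scale (complex_of_real a - z) (g a))"
proof -
  have f: "f = (\<Sum>a\<in>B. g a)" and g: "\<And>a. a \<in> B \<Longrightarrow> T (g a) = a *\<^sub>R g a"
    using assms by (auto simp: eigen_expansion_def)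
  have "fock_scale z f = (\<Sum>a\<in>B. fock_scale z (g a))"
    unfolding f by (rule linear_sum[OF bounded_linear.linear[OF bounded_linear_fock_scale]])
  moreover have "T f = (\<Sum>a\<in>B. a *\<^sub>R g a)"
    unfolding f T_sum using g by simp
  moreover have "a *\<^sub>R g a - fock_scale z (g a) = fock_scale (complex_of_real a - z) (g a)" for a
    by (rule mono_fock_eqI) (simp add: coord_diff coord_basic fock_scale.rep_eq algebra_simps)
  ultimately show ?thesis by (simp add: sum_subtractf[symmetric])
qed

lemma vacuum_moments:
  assumes "eigen_expansion T B vacuum g"
  shows "fock_cinner ((T ^^ p) vacuum) vacuum = complex_of_real (\<Sum>a\<in>B. (norm (g a))\<^sup>2 * a ^ p)"
proof -
  have vac: "vacuum = (\<Sum>a\<in>B. g a)" and g: "\<And>a. a \<in> B \<Longrightarrow> T (g a) = a *\<^sub>R g a"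
    using assms by (auto simp: eigen_expansion_def)
  have "(T ^^ p) vacuum = (\<Sum>a\<in>B. a ^ p *\<^sub>R g a)"
  proof (induction p)
    case (Suc p)
    then show ?case
      by (simp add: T_sum T_linear g mult.commute)
  qed (simp add: vac)
  moreover have "fock_cinner (g a) vacuum = complex_of_real ((norm (g a))\<^sup>2)" if "a \<in> B" for a
  proof -
    have "fock_cinner (g a) vacuum = fock_cinner (g a) (g a)"
      unfolding vac fock_cinner_sum_right using that finite_B
      by (subst sum.remove[of _ a])
        (auto intro!: sum.neutral expansion_orthogonal[OF assms])
    thus ?thesis by (simp only: fock_cinner_self_norm)
  qed
  ultimately show ?thesis
    by (simp add: fock_cinner_sum_left fock_cinner_scaleR_left mult.commute)
qed

text \<open>
  An eigenvector for \<open>a\<close> is orthogonal to all components of the vacuum except the one for \<open>a\<close>. So if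
  that component were 0, the eigenvector would be orthogonal to the vacuum.
\<close>

lemma expansion_vacuum_nonzero:
  assumes "eigen_expansion T B vacuum g" "a \<in> B"
  shows "g a \<noteq> 0"
proof
  assume "g a = 0"
  obtain h where h: "T h = a *\<^sub>R h" "coord h [] \<noteq> 0" using eigenvector[OF assms(2)] by auto
  have "fock_cinner (g b) h = 0" if "b \<in> B" for b
  proof (cases "b = a")
    case False
    thus ?thesis
      using eigenvectors_orthogonal[OF symmetric _ h(1)] assms(1) that
      by (auto simp: eigen_expansion_def)
  qed (simp add: \<open>g a = 0\<close> fock_cinner_zero_left)
  hence "fock_cinner vacuum h = 0"
    using assms(1) fock_cinner_sum_left[of g B h] by (simp add: eigen_expansion_def)
  hence "coord h [] = 0"
    using fock_cinner_commute[of h vacuum] by (simp add: coord_vacuum_eq_cinner)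
  thus False using h(2) by simp
qed

lemma vacuum_distribution_eq_atomic:
  obtains w where "\<And>a. a \<in> B \<Longrightarrow> 0 < w a" "vacuum_distribution T = atomic_measure B w"
proof -
  obtain g where g: "eigen_expansion T B vacuum g" using expansion by blast
  define w where "w a = (norm (g a))\<^sup>2" for a
  have pos: "0 < w a" if "a \<in> B" for a
    using expansion_vacuum_nonzero[OF g that] by (simp add: w_def)
  have total: "(\<Sum>a\<in>B. w a) = 1"
    using norm_expansion[OF g] by (simp add: w_def norm_vacuum)
  note moments = vacuum_moments[OF g, folded w_def]
  have nonneg: "\<And>a. a \<in> B \<Longrightarrow> 0 \<le> w a" using pos less_imp_le by blast
  have "vacuum_distribution T = atomic_measure B w"
    unfolding vacuum_distribution_def
  proof (rule the_equality, intro conjI allI)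
    show "prob_space (atomic_measure B w)"
      by (rule prob_space_atomic_measure[OF finite_B nonneg total])
    show "compact (measure_support (atomic_measure B w))"
      using finite_B by (simp add: measure_support_atomic_measure[OF finite_B pos] finite_imp_compact)
    show "complex_of_real (\<integral>x. x ^ p \<partial>atomic_measure B w) = fock_cinner ((T ^^ p) vacuum) vacuum" for p
      by (simp only: moments integral_power_atomic_measure[OF finite_B nonneg])
  next
    fix M :: "real measure"
    assume M: "prob_space M \<and> sets M = sets borel \<and> compact (measure_support M) \<and>
      (\<forall>p. complex_of_real (\<integral>x. x ^ p \<partial>M) = fock_cinner ((T ^^ p) vacuum) vacuum)"
    hence int: "(\<integral>x. x ^ p \<partial>M) = (\<Sum>a\<in>B. w a * a ^ p)" for p
      unfolding moments of_real_eq_iff by blast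
    interpret prob_space M using M by blast
    show "M = atomic_measure B w"
    proof (rule measure_eqI)
      fix U assume "U \<in> sets M"
      hence U: "U \<in> sets borel" using M by simp
      have "measure M U = (\<Sum>b\<in>B \<inter> U. w b)"
        using M by (intro finite_moment_problem_determinate[OF _ _ _ finite_B int U]) auto
      thus "emeasure M U = emeasure (atomic_measure B w) U"
        by (simp add: emeasure_atomic_measure[OF finite_B nonneg U] emeasure_eq_measure)
    qed (use M in simp)
  qed simp
  with pos show thesis using that by blast
qed

lemma measure_atoms_vacuum_distribution: "measure_atoms (vacuum_distribution T) = B"
  by (rule vacuum_distribution_eq_atomic) (simp add: measure_atoms_atomic_measure finite_B)

lemma measure_support_vacuum_distribution: "measure_support (vacuum_distribution T) = B"
  by (rule vacuum_distribution_eq_atomic) (simp add: measure_support_atomic_measure finite_B)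

lemma eigenvalue_in_spectrum:
  assumes "a \<in> B"
  shows "complex_of_real a \<in> fock_spectrum T"
proof -
  obtain h where h: "T h = a *\<^sub>R h" "coord h [] \<noteq> 0" using eigenvector[OF assms] by auto
  have "\<not> bounded_clinear_fock R" if "\<forall>f. R (T f - fock_scale (complex_of_real a) f) = f" for R
  proof
    assume "bounded_clinear_fock R"
    hence "R 0 = 0"
      by (simp add: bounded_clinear_fock_def linear_simps)
    moreover have "R (T h - fock_scale (complex_of_real a) h) = h" using that by blast
    ultimately have "h = 0" using h(1) by (simp add: fock_scale_of_real)
    with h(2) show False by (simp add: coord_basic)
  qed
  thus ?thesis by (auto simp: fock_spectrum_def)
qed

text \<open>
  Away from \<open>B\<close>, the operator \<open>T - z\<close> is bounded below by Pythagoras' theorem, and it is onto because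
  each term of an expansion can be divided by \<open>a - z\<close>. A linear bijection that is bounded below has
  a bounded inverse.
\<close>

lemma not_in_spectrum:
  assumes z: "z \<notin> complex_of_real ` B"
  shows "z \<notin> fock_spectrum T"
proof -
  define D where "D f = T f - fock_scale z f" for f
  have D_diff: "D (f - g) = D f - D g" for f g
    by (simp add: D_def T_linear fock_scale_diff_right)
  \<comment> \<open>The 1 keeps the minimum meaningful if there are no eigenvalues.\<close>
  define d where "d = Min (insert 1 ((\<lambda>a. cmod (complex_of_real a - z)) ` B))"
  have d: "0 < d" "\<And>a. a \<in> B \<Longrightarrow> d \<le> cmod (complex_of_real a - z)"
    unfolding d_def using finite_B z by (auto simp: Min_gr_iff)
  have lower: "d * norm f \<le> norm (D f)" for f
  proof -
    obtain g where g: "eigen_expansion T B f g" using expansion by blast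
    have "(d * norm f)\<^sup>2 = (\<Sum>a\<in>B. d\<^sup>2 * (norm (g a))\<^sup>2)"
      by (simp add: power_mult_distrib norm_expansion[OF g] sum_distrib_left)
    also have "\<dots> \<le> (\<Sum>a\<in>B. (cmod (complex_of_real a - z))\<^sup>2 * (norm (g a))\<^sup>2)"
      using d by (intro sum_mono mult_right_mono power_mono) (auto intro: less_imp_le)
    also have "\<dots> = (norm (D f))\<^sup>2"
      unfolding D_def T_minus_expansion[OF g] norm_scaled_expansion[OF g] ..
    finally show ?thesis by (rule power2_le_imp_le) simp
  qed
  have inj: "f = g" if "D f = D g" for f g
    using lower[of "f - g"] that d(1) by (simp add: D_diff mult_le_0_iff)
  have surj: "\<exists>f. D f = h" for h
  proof -
    obtain g where g: "eigen_expansion T B h g" using expansion by blast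
    define g' where "g' a = fock_scale (inverse (complex_of_real a - z)) (g a)" for a
    have "eigen_expansion T B (\<Sum>a\<in>B. g' a) g'"
      using g by (auto intro!: mono_fock_eqI
          simp: g'_def eigen_expansion_def T_scale coord_basic fock_scale.rep_eq)
    hence "D (\<Sum>a\<in>B. g' a) = (\<Sum>a\<in>B. fock_scale (complex_of_real a - z) (g' a))"
      unfolding D_def by (rule T_minus_expansion)
    also have "\<dots> = (\<Sum>a\<in>B. g a)"
    proof (rule sum.cong[OF refl])
      fix a assume "a \<in> B"
      hence "complex_of_real a - z \<noteq> 0" using z by auto
      thus "fock_scale (complex_of_real a - z) (g' a) = g a"
        by (intro mono_fock_eqI) (simp add: g'_def fock_scale.rep_eq)
    qed
    finally show ?thesis using g by (auto simp: eigen_expansion_def)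
  qed
  define R where "R = inv D"
  have DR: "D (R f) = f" for f
    unfolding R_def using surj by (metis f_inv_into_f rangeI)
  have RD: "R (D f) = f" for f using DR inj by blast
  have "bounded_linear R"
  proof (rule bounded_linear_intro[of _ "inverse d"])
    show "R (f + g) = R f + R g" for f g
    proof (rule inj)
      have "D (R f + R g) = D (R f) + D (R g)"
        using D_diff[of "R f + R g" "R g"] by simp
      thus "D (R (f + g)) = D (R f + R g)" by (simp add: DR)
    qed
    show "R (r *\<^sub>R f) = r *\<^sub>R R f" for r f
    proof (rule inj)
      have "D (r *\<^sub>R R f) = r *\<^sub>R D (R f)"
        unfolding D_def T_linear(5)
        by (rule mono_fock_eqI) (simp add: coord_diff coord_basic fock_scale.rep_eq algebra_simps)
      thus "D (R (r *\<^sub>R f)) = D (r *\<^sub>R R f)" by (simp add: DR)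
    qed
    show "norm (R f) \<le> norm f * inverse d" for f
      using lower[of "R f"] d(1) by (simp add: DR field_simps)
  qed
  moreover have "R (fock_scale c f) = fock_scale c (R f)" for c f
  proof (rule inj)
    have "D (fock_scale c (R f)) = fock_scale c (D (R f))"
      unfolding D_def T_scale
      by (rule mono_fock_eqI) (simp add: coord_diff fock_scale.rep_eq algebra_simps)
    thus "D (R (fock_scale c f)) = D (fock_scale c (R f))" by (simp add: DR)
  qed
  ultimately have "bounded_clinear_fock R" by (simp add: bounded_clinear_fock_def)
  with DR RD show ?thesis unfolding fock_spectrum_def D_def by blast
qed

lemma fock_spectrum_eq: "fock_spectrum T = complex_of_real ` B"
  using eigenvalue_in_spectrum not_in_spectrum by blast

lemma onorm_eq_Max:
  assumes "B \<noteq> {}" and sym: "\<And>a. a \<in> B \<Longrightarrow> - a \<in> B"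
  shows "onorm T = Max B"
proof (rule antisym)
  have le_Max: "\<bar>a\<bar> \<le> Max B" if "a \<in> B" for a
    using that sym[OF that] finite_B by (auto simp: abs_le_iff)
  have "0 \<le> Max B" using assms(1) le_Max by force
  show "onorm T \<le> Max B"
  proof (rule onorm_bound[OF \<open>0 \<le> Max B\<close>])
    fix f
    obtain g where g: "eigen_expansion T B f g" using expansion by blast
    have "T f = (\<Sum>a\<in>B. fock_scale (complex_of_real a) (g a))"
      using T_minus_expansion[OF g, of 0] fock_scale_of_real[of 0] by simp
    hence "(norm (T f))\<^sup>2 = (\<Sum>a\<in>B. \<bar>a\<bar>\<^sup>2 * (norm (g a))\<^sup>2)"
      using norm_scaled_expansion[OF g, of complex_of_real] by simp
    also have "\<dots> \<le> (\<Sum>a\<in>B. (Max B)\<^sup>2 * (norm (g a))\<^sup>2)"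
      by (intro sum_mono mult_right_mono power_mono le_Max) auto
    also have "\<dots> = (Max B * norm f)\<^sup>2"
      by (simp add: power_mult_distrib norm_expansion[OF g] sum_distrib_left)
    finally show "norm (T f) \<le> Max B * norm f"
      by (rule power2_le_imp_le) (simp add: \<open>0 \<le> Max B\<close>)
  qed
  have "Max B \<in> B" using finite_B assms(1) by simp
  then obtain h where h: "T h = Max B *\<^sub>R h" "coord h [] \<noteq> 0" using eigenvector by blast
  have "h \<noteq> 0" using h(2) by (auto simp: coord_basic)
  have "norm (T h) \<le> onorm T * norm h" by (rule onorm[OF bounded_linear_T])
  thus "Max B \<le> onorm T" using h(1) \<open>0 \<le> Max B\<close> \<open>h \<noteq> 0\<close> by simp
qed

end


section \<open>The atoms as iterated preimages of 0\<close>

text \<open>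
  The map \<open>x \<mapsto> x - 1/x\<close> on the nonzero reals is two-to-one onto the line, and the roots of \<open>x\<^sup>2 - r x - 1\<close> are the
  preimages of \<open>r\<close>. Starting the recursion at \<open>{0}\<close>, the spectrum of the empty sum, makes it uniform.
\<close>

fun iterated_preimage :: "nat \<Rightarrow> real set" where
  "iterated_preimage 0 = {0}"
| "iterated_preimage (Suc k) = {x. x \<noteq> 0 \<and> x - 1 / x \<in> iterated_preimage k}"

lemma preimage_eq:
  fixes r :: real
  shows "{x. x \<noteq> 0 \<and> x - 1 / x = r} = {(r + sqrt (r\<^sup>2 + 4)) / 2, (r - sqrt (r\<^sup>2 + 4)) / 2}"
proof -
  define s where "s = sqrt (r\<^sup>2 + 4)"
  have s2: "s\<^sup>2 = r\<^sup>2 + 4" by (simp add: s_def)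
  have "x \<noteq> 0 \<and> x - 1 / x = r \<longleftrightarrow> x\<^sup>2 - r * x - 1 = 0" for x
  proof (cases "x = 0")
    case False
    hence "x\<^sup>2 - r * x - 1 = x * (x - 1 / x - r)"
      by (simp add: algebra_simps power2_eq_square)
    thus ?thesis using False by simp
  qed simp
  moreover have "x\<^sup>2 - r * x - 1 = (x - (r + s) / 2) * (x - (r - s) / 2)" for x
    using s2 by (simp add: field_simps power2_eq_square)
  ultimately show ?thesis unfolding s_def by (auto simp only: mult_eq_0_iff)
qed

lemma iterated_preimage_Suc:
  "iterated_preimage (Suc k) = (\<Union>r\<in>iterated_preimage k. {x. x \<noteq> 0 \<and> x - 1 / x = r})"
  by auto

lemma finite_iterated_preimage: "finite (iterated_preimage k)"
  by (induction k) (simp, simp only: iterated_preimage_Suc preimage_eq, simp)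

lemma atom_set_eq: "atom_set (Suc k) = iterated_preimage (Suc k)"
proof (induction k)
  case 0
  show ?case by (simp only: iterated_preimage_Suc preimage_eq) simp
next
  case (Suc k)
  show ?case
    by (simp only: iterated_preimage_Suc[of "Suc k"] preimage_eq atom_set.simps Suc.IH)
qed

lemma iterated_preimage_uminus: "x \<in> iterated_preimage k \<Longrightarrow> - x \<in> iterated_preimage k"
proof (induction k arbitrary: x)
  case (Suc k)
  then show ?case using Suc.IH[of "x - 1 / x"] by simp
qed simp

lemma iterated_preimage_nonempty: "iterated_preimage k \<noteq> {}"
  by (induction k) (simp, simp only: iterated_preimage_Suc preimage_eq, simp)

text \<open>
  For \<open>x - 1/x = r\<close> the vectors \<open>(1, 1/x)\<close> are the eigenvectors of the symmetric matrix with rows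
  \<open>(r, 1)\<close> and \<open>(1, 0)\<close>. Its eigenprojections sum to the identity; these are the entries.
\<close>

lemma sum_preimage_projections:
  fixes r :: real
  defines "X \<equiv> {x. x \<noteq> 0 \<and> x - 1 / x = r}"
  shows "finite X" "(\<Sum>x\<in>X. x\<^sup>2 / (x\<^sup>2 + 1)) = 1" "(\<Sum>x\<in>X. x / (x\<^sup>2 + 1)) = 0"
    "(\<Sum>x\<in>X. 1 / (x\<^sup>2 + 1)) = 1"
proof -
  define p where "p = (r + sqrt (r\<^sup>2 + 4)) / 2"
  have "sqrt (r\<^sup>2 + 4) > \<bar>r\<bar>" by (rule real_less_rsqrt) simp
  hence "p > 0" by (auto simp: p_def)
  have s2: "(sqrt (r\<^sup>2 + 4))\<^sup>2 = r\<^sup>2 + 4" by simp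
  have "p * ((r - sqrt (r\<^sup>2 + 4)) / 2) = - 1"
    using s2 by (simp add: p_def field_simps power2_eq_square)
  hence q: "(r - sqrt (r\<^sup>2 + 4)) / 2 = - 1 / p"
    using \<open>p > 0\<close> by (simp add: field_simps)
  define y where "y = - 1 / p"
  have X: "X = {p, y}" unfolding X_def preimage_eq p_def[symmetric] q y_def by simp
  have "y < 0" using \<open>p > 0\<close> by (simp add: y_def)
  hence "p \<noteq> y" using \<open>p > 0\<close> by linarith
  hence sum_X: "(\<Sum>x\<in>X. h x) = h p + h y" for h :: "real \<Rightarrow> real" by (simp add: X)
  have pos: "p\<^sup>2 + 1 > 0" by (rule add_nonneg_pos) simp_all
  have "y\<^sup>2 + 1 = (p\<^sup>2 + 1) / p\<^sup>2"
    using \<open>p > 0\<close> by (simp add: y_def field_simps power2_eq_square)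
  hence y: "y\<^sup>2 / (y\<^sup>2 + 1) = 1 / (p\<^sup>2 + 1)" "y / (y\<^sup>2 + 1) = - (p / (p\<^sup>2 + 1))"
    "1 / (y\<^sup>2 + 1) = p\<^sup>2 / (p\<^sup>2 + 1)"
    using \<open>p > 0\<close> by (simp_all add: y_def power2_eq_square)
  show "finite X" by (simp add: X)
  show "(\<Sum>x\<in>X. x\<^sup>2 / (x\<^sup>2 + 1)) = 1" "(\<Sum>x\<in>X. x / (x\<^sup>2 + 1)) = 0" "(\<Sum>x\<in>X. 1 / (x\<^sup>2 + 1)) = 1"
    unfolding sum_X y using pos by (simp_all add: add_divide_distrib[symmetric])
qed


section \<open>Splitting off the smallest letter\<close>

definition letters_above :: "nat \<Rightarrow> mono_fock \<Rightarrow> bool" where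
  "letters_above i f \<longleftrightarrow> (\<forall>xs. coord f xs \<noteq> 0 \<longrightarrow> set xs \<subseteq> {i<..})"

text \<open>
  The lower end \<open>i\<close> is a parameter because the induction on the number \<open>k\<close> of letters removes the
  smallest one. The vectors that avoid the letters up to \<open>i\<close> are those on which the block is studied.
\<close>

definition position_block :: "nat \<Rightarrow> nat \<Rightarrow> mono_fock \<Rightarrow> mono_fock" where
  "position_block i k f = (\<Sum>j\<in>{i<..i + k}. position j f)"

lemma letters_above_0: "letters_above 0 f"
  unfolding letters_above_def using coord_outside[of _ f] by (force simp: mono_indices_iff)

lemma letters_above_vacuum: "letters_above i vacuum"
  by (auto simp: letters_above_def vacuum_def fock_basis.rep_eq split: if_splits)

lemma letters_above_add: "letters_above i f \<Longrightarrow> letters_above i g \<Longrightarrow> letters_above i (f + g)"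
  unfolding letters_above_def coord_basic by (metis add.right_neutral)

lemma letters_above_scaleR: "letters_above i f \<Longrightarrow> letters_above i (r *\<^sub>R f)"
  by (simp add: letters_above_def coord_basic)

lemma letters_above_mono: "letters_above (Suc i) f \<Longrightarrow> letters_above i f"
  unfolding letters_above_def by fastforce

lemma letters_above_creation:
  "letters_above (Suc i) f \<Longrightarrow> letters_above i (creation (Suc i) f)"
  unfolding letters_above_def creation.rep_eq by (fastforce split: list.splits if_splits)

lemma bounded_linear_creation: "bounded_linear (creation i)"
  using bounded_clinear_creation by (simp add: bounded_clinear_fock_def)

lemma bounded_linear_annihilation: "bounded_linear (annihilation i)"
  using bounded_clinear_annihilation by (simp add: bounded_clinear_fock_def)

lemma bounded_linear_position: "bounded_linear (position i)"
  unfolding position_def[abs_def]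
  by (intro bounded_linear_add bounded_linear_annihilation bounded_linear_creation)

lemma bounded_linear_position_block: "bounded_linear (position_block i k)"
  unfolding position_block_def[abs_def]
  by (intro bounded_linear_sum bounded_linear_position)

lemmas creation_linear = linear_simps[OF bounded_linear_creation]
lemmas position_linear = linear_simps[OF bounded_linear_position]
lemmas position_block_linear = linear_simps[OF bounded_linear_position_block]

lemma annihilation_above: "letters_above i u \<Longrightarrow> annihilation i u = 0"
  by (rule mono_fock_eqI) (force simp: letters_above_def annihilation.rep_eq coord_basic)

lemma annihilation_creation_above:
  assumes "letters_above i v" "1 \<le> i"
  shows "annihilation i (creation i v) = v"
proof (rule mono_fock_eqI)
  fix xs
  have "i # xs \<in> mono_indices" if "coord v xs \<noteq> 0"
    using that assms coord_outside[of xs v] by (force simp: letters_above_def mono_indices_iff)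
  thus "coord (annihilation i (creation i v)) xs = coord v xs"
    by (auto simp: annihilation.rep_eq creation.rep_eq)
qed

lemma annihilation_creation_neq: "i \<noteq> j \<Longrightarrow> annihilation i (creation j f) = 0"
  by (rule mono_fock_eqI) (simp add: annihilation.rep_eq creation.rep_eq coord_basic)

lemma creation_creation: "j \<le> i \<Longrightarrow> creation i (creation j f) = 0"
  by (rule mono_fock_eqI) (auto simp: creation.rep_eq coord_basic mono_indices_iff split: list.split)

lemma position_creation_greater: "i < j \<Longrightarrow> position j (creation i v) = 0"
  by (simp add: position_def annihilation_creation_neq creation_creation)

lemma position_above: "letters_above i u \<Longrightarrow> position i u = creation i u"
  by (simp add: position_def annihilation_above)

lemma position_creation_same:
  "letters_above i v \<Longrightarrow> 1 \<le> i \<Longrightarrow> position i (creation i v) = v"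
  by (simp add: position_def annihilation_creation_above creation_creation)

text \<open>
  On the vectors \<open>u + a\<^sub>m\<^sup>\<dagger> v\<close>, where \<open>m = i + 1\<close> is the smallest letter of the block and \<open>u\<close>, \<open>v\<close>
  avoid it, the block acts as the matrix with rows \<open>(U, 1)\<close> and \<open>(1, 0)\<close>, \<open>U\<close> being the block
  without \<open>m\<close>: a leading letter \<open>m\<close> protects the remaining letters from all later operators.
\<close>

lemma position_block_Suc:
  assumes u: "letters_above (Suc i) u" and v: "letters_above (Suc i) v"
  shows "position_block i (Suc k) (u + creation (Suc i) v) =
    position_block (Suc i) k u + v + creation (Suc i) u"
proof -
  have "{i<..i + Suc k} = insert (Suc i) {Suc i<..Suc i + k}" by auto
  hence "position_block i (Suc k) f = position (Suc i) f + position_block (Suc i) k f" for f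
    by (simp add: position_block_def)
  moreover have "position_block (Suc i) k (creation (Suc i) v) = 0"
    by (simp add: position_block_def position_creation_greater)
  ultimately show ?thesis
    using u v by (simp add: position_linear position_block_linear position_above position_creation_same)
qed

lemma position_block_lift_eigenvector:
  assumes "letters_above (Suc i) w" "position_block (Suc i) k w = (x - 1 / x) *\<^sub>R w" "x \<noteq> 0"
  shows "position_block i (Suc k) (w + creation (Suc i) ((1 / x) *\<^sub>R w)) =
    x *\<^sub>R (w + creation (Suc i) ((1 / x) *\<^sub>R w))"
  using assms
  by (subst position_block_Suc)
    (simp_all add: letters_above_scaleR creation_linear scaleR_add_right scaleR_left_diff_distrib)

lemma position_block_eigenvector:
  assumes "a \<in> iterated_preimage k"
  shows "\<exists>h. letters_above i h \<and> position_block i k h = a *\<^sub>R h \<and> coord h [] \<noteq> 0"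
  using assms
proof (induction k arbitrary: i a)
  case 0
  then show ?case
    by (intro exI[of _ vacuum])
      (use letters_above_vacuum[of i] in
        \<open>auto simp: position_block_def vacuum_def fock_basis.rep_eq mono_indices_iff\<close>)
next
  case (Suc k)
  hence a: "a \<noteq> 0" "a - 1 / a \<in> iterated_preimage k" by auto
  obtain w where w: "letters_above (Suc i) w" "position_block (Suc i) k w = (a - 1 / a) *\<^sub>R w"
    "coord w [] \<noteq> 0" using Suc.IH[OF a(2)] by blast
  let ?h = "w + creation (Suc i) ((1 / a) *\<^sub>R w)"
  have "letters_above i ?h"
    using w(1) by (intro letters_above_add letters_above_creation letters_above_scaleR)
      (simp_all add: letters_above_mono)
  moreover have "coord ?h [] \<noteq> 0" using w(3) by (simp add: coord_basic creation.rep_eq)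
  ultimately show ?case
    using position_block_lift_eigenvector[OF w(1,2) a(1)] by blast
qed

text \<open>
  The summands collect the words that do not start with the letter \<open>i + 1\<close> and those that do. As
  words increase strictly, that letter cannot occur elsewhere in a word with letters above \<open>i\<close>.
\<close>

lemma split_smallest_letter:
  assumes "letters_above i f"
  obtains u v where "letters_above (Suc i) u" "letters_above (Suc i) v"
    "f = u + creation (Suc i) v"
proof -
  let ?v = "annihilation (Suc i) f"
  let ?u = "f - creation (Suc i) ?v"
  have f: "set xs \<subseteq> {i<..} \<and> sorted_wrt (<) xs" if "coord f xs \<noteq> 0" for xs
    using assms that coord_outside[of xs f] by (auto simp: letters_above_def mono_indices_iff)
  have v_above: "letters_above (Suc i) ?v"
    unfolding letters_above_def annihilation.rep_eq using f by fastforce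
  have u: "coord ?u xs = (case xs of [] \<Rightarrow> coord f xs | j # ys \<Rightarrow> if j = Suc i then 0 else coord f xs)" for xs
    by (auto simp: coord_diff creation.rep_eq annihilation.rep_eq coord_outside split: list.split)
  have "letters_above (Suc i) ?u"
    unfolding letters_above_def u
  proof (intro allI impI)
    fix xs
    assume *: "(case xs of [] \<Rightarrow> coord f xs | j # ys \<Rightarrow> if j = Suc i then 0 else coord f xs) \<noteq> 0"
    show "set xs \<subseteq> {Suc i<..}"
    proof (cases xs)
      case (Cons j ys)
      with * have "coord f (j # ys) \<noteq> 0" "j \<noteq> Suc i" by (auto split: if_splits)
      with f[of "j # ys"] Cons show ?thesis by force
    qed simp
  qed
  thus thesis by (rule that[OF _ v_above]) simp
qed

text \<open>
  The eigenvectors of the block come in pairs from those of the smaller block, one for each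
  preimage of the eigenvalue, and the expansions of \<open>u\<close> and \<open>v\<close> recombine to one of
  \<open>u + a\<^sub>m\<^sup>\<dagger> v\<close> by the eigenprojections of the matrix with rows \<open>(r, 1)\<close> and \<open>(1, 0)\<close>.
\<close>

lemma position_block_expansion:
  assumes "letters_above i f"
  shows "\<exists>g. eigen_expansion (position_block i k) (iterated_preimage k) f g \<and>
    (\<forall>a\<in>iterated_preimage k. letters_above i (g a))"
  using assms
proof (induction k arbitrary: i f)
  case 0
  then show ?case
    by (intro exI[of _ "\<lambda>_. f"]) (simp add: eigen_expansion_def position_block_def)
next
  case (Suc k)
  let ?P = "iterated_preimage k" and ?c = "creation (Suc i)"
  let ?X = "\<lambda>r. {x::real. x \<noteq> 0 \<and> x - 1 / x = r}"
  obtain u v where uv: "letters_above (Suc i) u" "letters_above (Suc i) v" "f = u + ?c v"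
    using split_smallest_letter[OF Suc.prems] .
  obtain g\<^sub>u where gu: "eigen_expansion (position_block (Suc i) k) ?P u g\<^sub>u"
      "\<forall>a\<in>?P. letters_above (Suc i) (g\<^sub>u a)" using Suc.IH[OF uv(1)] by blast
  obtain g\<^sub>v where gv: "eigen_expansion (position_block (Suc i) k) ?P v g\<^sub>v"
      "\<forall>a\<in>?P. letters_above (Suc i) (g\<^sub>v a)" using Suc.IH[OF uv(2)] by blast
  define W where "W x r = (x\<^sup>2 / (x\<^sup>2 + 1)) *\<^sub>R g\<^sub>u r + (x / (x\<^sup>2 + 1)) *\<^sub>R g\<^sub>v r" for x r
  define g where "g x = W x (x - 1 / x) + ?c ((1 / x) *\<^sub>R W x (x - 1 / x))" for x
  have W_above: "letters_above (Suc i) (W x r)" if "r \<in> ?P" for x r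
    unfolding W_def using that gu(2) gv(2) by (intro letters_above_add letters_above_scaleR) auto
  have W_eigen: "position_block (Suc i) k (W x r) = r *\<^sub>R W x r" if "r \<in> ?P" for x r
    unfolding W_def using that gu(1) gv(1)
    by (simp add: position_block_linear eigen_expansion_def scaleR_add_right mult.commute)
  have fibre: "(\<Sum>x\<in>?X r. g x) = g\<^sub>u r + ?c (g\<^sub>v r)" for r
  proof -
    note X = sum_preimage_projections[of r]
    have "(1 / x) *\<^sub>R W x r = (x / (x\<^sup>2 + 1)) *\<^sub>R g\<^sub>u r + (1 / (x\<^sup>2 + 1)) *\<^sub>R g\<^sub>v r" if "x \<noteq> 0" for x
      using that by (simp add: W_def scaleR_add_right power2_eq_square)
    hence "(\<Sum>x\<in>?X r. g x) = (\<Sum>x\<in>?X r.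
        ((x\<^sup>2 / (x\<^sup>2 + 1)) *\<^sub>R g\<^sub>u r + (x / (x\<^sup>2 + 1)) *\<^sub>R g\<^sub>v r) +
        ((x / (x\<^sup>2 + 1)) *\<^sub>R ?c (g\<^sub>u r) + (1 / (x\<^sup>2 + 1)) *\<^sub>R ?c (g\<^sub>v r)))"
      by (intro sum.cong) (auto simp: g_def creation_linear W_def)
    also have "\<dots> = g\<^sub>u r + ?c (g\<^sub>v r)"
      by (simp only: sum.distrib scaleR_left.sum[symmetric] X) simp
    finally show ?thesis .
  qed
  have "(\<Sum>x\<in>iterated_preimage (Suc k). g x) = (\<Sum>r\<in>?P. \<Sum>x\<in>?X r. g x)"
    unfolding iterated_preimage_Suc
    by (rule sum.UNION_disjoint)
      (auto simp: finite_iterated_preimage sum_preimage_projections(1))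
  also have "\<dots> = (\<Sum>r\<in>?P. g\<^sub>u r) + ?c (\<Sum>r\<in>?P. g\<^sub>v r)"
    unfolding fibre sum.distrib
    by (simp add: linear_sum[OF bounded_linear.linear[OF bounded_linear_creation]])
  also have "\<dots> = f"
    using gu(1) gv(1) uv(3) by (simp add: eigen_expansion_def)
  finally have sum: "(\<Sum>x\<in>iterated_preimage (Suc k). g x) = f" .
  have "position_block i (Suc k) (g x) = x *\<^sub>R g x \<and> letters_above i (g x)"
    if "x \<in> iterated_preimage (Suc k)" for x
  proof
    from that have x: "x \<noteq> 0" "x - 1 / x \<in> ?P" by auto
    show "position_block i (Suc k) (g x) = x *\<^sub>R g x"
      unfolding g_def by (rule position_block_lift_eigenvector[OF W_above[OF x(2)] W_eigen[OF x(2)] x(1)])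
    show "letters_above i (g x)"
      unfolding g_def using W_above[OF x(2)]
      by (intro letters_above_add letters_above_creation letters_above_scaleR)
        (rule letters_above_mono)
  qed
  with sum show ?case unfolding eigen_expansion_def by blast
qed


section \<open>The sum of the position operators\<close>

lemma position_sum_eq_block: "position_sum n = position_block 0 n"
proof -
  have "{1..n} = {0<..0 + n}" by auto
  thus ?thesis by (simp add: fun_eq_iff position_sum_def position_block_def)
qed

lemma fock_cinner_annihilation: "fock_cinner (annihilation i f) g = fock_cinner f (creation i g)"
  by (metis fock_cinner_commute fock_cinner_creation)

lemma symmetric_position_sum: "symmetric_fock (position_sum n)"
  unfolding symmetric_fock_def position_sum_def position_def
  by (simp add: fock_cinner_sum_left fock_cinner_sum_right fock_cinner_add_left
      fock_cinner_add_right fock_cinner_creation fock_cinner_annihilation add.commute)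

lemma bounded_clinear_position_sum: "bounded_clinear_fock (position_sum n)"
  unfolding bounded_clinear_fock_def
proof (intro conjI allI)
  show "bounded_linear (position_sum n)"
    by (simp add: position_sum_eq_block bounded_linear_position_block)
  fix c f
  have "position i (fock_scale c f) = fock_scale c (position i f)" for i
    using bounded_clinear_creation[of i] bounded_clinear_annihilation[of i]
      linear_simps(1)[OF bounded_linear_fock_scale]
    by (simp add: bounded_clinear_fock_def position_def)
  thus "position_sum n (fock_scale c f) = fock_scale c (position_sum n f)"
    by (simp add: position_sum_def linear_sum[OF bounded_linear.linear[OF bounded_linear_fock_scale]])
qed

lemma finite_spectral_position_sum: "finite_spectral_fock (position_sum n) (iterated_preimage n)"
proof
  show "\<exists>g. eigen_expansion (position_sum n) (iterated_preimage n) f g" for f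
    using position_block_expansion[OF letters_above_0] unfolding position_sum_eq_block by blast
  show "\<exists>h. position_sum n h = a *\<^sub>R h \<and> coord h [] \<noteq> 0" if "a \<in> iterated_preimage n" for a
    using position_block_eigenvector[OF that] unfolding position_sum_eq_block by blast
qed (rule bounded_clinear_position_sum symmetric_position_sum finite_iterated_preimage)+

theorem theorem4p2:
  fixes n :: nat
  assumes "1 \<le> n"
  shows "measure_atoms (vacuum_distribution (position_sum n)) = atom_set n
    \<and> fock_spectrum (position_sum n) =
      complex_of_real ` measure_support (vacuum_distribution (position_sum n))
    \<and> onorm (position_sum n) = Max (atom_set n)"
proof -
  interpret finite_spectral_fock "position_sum n" "iterated_preimage n"
    by (rule finite_spectral_position_sum)
  have "atom_set n = iterated_preimage n"
    using assms atom_set_eq[of "n - 1"] by simp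
  thus ?thesis
    using onorm_eq_Max[OF iterated_preimage_nonempty iterated_preimage_uminus]
    by (simp add: measure_atoms_vacuum_distribution measure_support_vacuum_distribution
        fock_spectrum_eq)
qed

end
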